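(* Let $\alpha$ be an ordinal. Every dimension-complemented substitution algebra of dimension $\alpha$ is representable, i.e. isomorphic to a function substitution algebra of dimension $\alpha$.
   Context: For a nonempty set $U$, $F_\alpha(U)$ is the set of all functions $U^\alpha\to U$. For $s\in U^\alpha$, $\kappa<\alpha$, $x\in U$, $s\langle\kappa,x\rangle$ agrees with $s$ except that its $\kappa$-th entry is $x$. On $F_\alpha(U)$ set $(f*_\kappa g)(s)=g(s\langle\kappa,f(s)\rangle)$ and $V_\kappa(s)=s_\kappa$. A function substitution algebra of dimension $\alpha$ is $\langle A,*_\kappa,V_\kappa\rangle_{\kappa<\alpha}$ with $A\subseteq F_\alpha(U)$ closed under every $*_\kappa$ and containing every $V_\kappa$. A substitution algebra of dimension $\alpha$ is an algebra $\langle A,*_\kappa,v_\kappa\rangle_{\kappa<\alpha}$ satisfying, for all $\kappa,\lambda<\alpha$: (1) $x*_\kappa v_\kappa=x$; (2) $x*_\kappa v_\lambda=v_\lambda$ for $\kappa\neq\lambda$; (3) $v_\kappa*_\kappa x=x$; (4) if $w*_\lambda x=x$ for all $w$, then $x*_\lambda(v_\lambda*_\kappa z)=x*_\lambda(x*_\kappa z)$; (5) $(x*_\kappa y)*_\kappa z=x*_\kappa(y*_\kappa z)$; (6) if $w*_\lambda x=x$ for all $w$, then $x*_\kappa(y*_\lambda z)=(x*_\kappa y)*_\lambda(x*_\kappa z)$ for $\kappa\neq\lambda$. For $x\in A$, $\Delta x=\{\kappa<\alpha: a*_\kappa x\neq x\text{ for some }a\in A\}$. The algebra is dimension-complemented if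 for every finite $X\subseteq A$ the set $\alpha-\bigcup\{\Delta x:x\in X\}$ is infinite. *)

theory Defs
  imports Main "HOL-Library.FuncSet"
begin

text \<open>
  An ordinal \<open>\<alpha>\<close> is given by a well-order \<open>r\<close>; the indices \<open>\<kappa> < \<alpha>\<close> are
  the elements of \<open>Field r\<close>. The notions below use \<open>\<alpha>\<close> only as an index set, so they take
  that set \<open>I\<close> as parameter.
\<close>

record ('i, 'a) salg =
  elems :: "'a set"
  sub :: "'i \<Rightarrow> 'a \<Rightarrow> 'a \<Rightarrow> 'a"
  var :: "'i \<Rightarrow> 'a"

locale substitution_algebra =
  fixes I :: "'i set" and S :: "('i, 'a) salg"
  assumes sub_closed:
      "\<lbrakk>\<kappa> \<in> I; x \<in> elems S; y \<in> elems S\<rbrakk> \<Longrightarrow> sub S \<kappa> x y \<in> elems S"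
    and var_closed: "\<kappa> \<in> I \<Longrightarrow> var S \<kappa> \<in> elems S"
    and sub_var: "\<lbrakk>\<kappa> \<in> I; x \<in> elems S\<rbrakk> \<Longrightarrow> sub S \<kappa> x (var S \<kappa>) = x"
    and sub_var_other:
      "\<lbrakk>\<kappa> \<in> I; l \<in> I; \<kappa> \<noteq> l; x \<in> elems S\<rbrakk> \<Longrightarrow> sub S \<kappa> x (var S l) = var S l"
    and var_sub: "\<lbrakk>\<kappa> \<in> I; x \<in> elems S\<rbrakk> \<Longrightarrow> sub S \<kappa> (var S \<kappa>) x = x"
    and sub_rename:
      "\<lbrakk>\<kappa> \<in> I; l \<in> I; x \<in> elems S; z \<in> elems S; \<forall>w\<in>elems S. sub S l w x = x\<rbrakk>
        \<Longrightarrow> sub S l x (sub S \<kappa> (var S l) z) = sub S l x (sub S \<kappa> x z)"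
    and sub_assoc:
      "\<lbrakk>\<kappa> \<in> I; x \<in> elems S; y \<in> elems S; z \<in> elems S\<rbrakk>
        \<Longrightarrow> sub S \<kappa> (sub S \<kappa> x y) z = sub S \<kappa> x (sub S \<kappa> y z)"
    and sub_distrib:
      "\<lbrakk>\<kappa> \<in> I; l \<in> I; \<kappa> \<noteq> l; x \<in> elems S; y \<in> elems S; z \<in> elems S;
        \<forall>w\<in>elems S. sub S l w x = x\<rbrakk>
        \<Longrightarrow> sub S \<kappa> x (sub S l y z) = sub S l (sub S \<kappa> x y) (sub S \<kappa> x z)"

definition dimension_set :: "'i set \<Rightarrow> ('i, 'a) salg \<Rightarrow> 'a \<Rightarrow> 'i set" where
  "dimension_set I S x = {\<kappa> \<in> I. \<exists>a\<in>elems S. sub S \<kappa> a x \<noteq> x}"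

definition dimension_complemented :: "'i set \<Rightarrow> ('i, 'a) salg \<Rightarrow> bool" where
  "dimension_complemented I S \<longleftrightarrow>
    (\<forall>X. finite X \<and> X \<subseteq> elems S \<longrightarrow> infinite (I - (\<Union>x\<in>X. dimension_set I S x)))"

text \<open>
  Sequences and functions are extensional (\<open>undefined\<close> off their domain), so that HOL
  equality is equality of functions with the given domain.
\<close>

definition fn_space :: "'i set \<Rightarrow> 'u set \<Rightarrow> (('i \<Rightarrow> 'u) \<Rightarrow> 'u) set" where
  "fn_space I U = (I \<rightarrow>\<^sub>E U) \<rightarrow>\<^sub>E U"

definition fn_sub ::
  "'i set \<Rightarrow> 'u set \<Rightarrow> 'i \<Rightarrow> (('i \<Rightarrow> 'u) \<Rightarrow> 'u) \<Rightarrow> (('i \<Rightarrow> 'u) \<Rightarrow> 'u) \<Rightarrow> (('i \<Rightarrow> 'u) \<Rightarrow> 'u)" where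
  "fn_sub I U \<kappa> f g = (\<lambda>s\<in>I \<rightarrow>\<^sub>E U. g (s(\<kappa> := f s)))"

definition fn_var :: "'i set \<Rightarrow> 'u set \<Rightarrow> 'i \<Rightarrow> (('i \<Rightarrow> 'u) \<Rightarrow> 'u)" where
  "fn_var I U \<kappa> = (\<lambda>s\<in>I \<rightarrow>\<^sub>E U. s \<kappa>)"

definition function_substitution_algebra ::
  "'i set \<Rightarrow> ('i, ('i \<Rightarrow> 'u) \<Rightarrow> 'u) salg \<Rightarrow> bool" where
  "function_substitution_algebra I F \<longleftrightarrow>
    (\<exists>U A. U \<noteq> {} \<and> A \<subseteq> fn_space I U \<and>
      (\<forall>\<kappa>\<in>I. \<forall>f\<in>A. \<forall>g\<in>A. fn_sub I U \<kappa> f g \<in> A) \<and>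
      (\<forall>\<kappa>\<in>I. fn_var I U \<kappa> \<in> A) \<and>
      F = \<lparr>elems = A, sub = fn_sub I U, var = fn_var I U\<rparr>)"

definition salg_iso ::
  "'i set \<Rightarrow> ('i, 'a) salg \<Rightarrow> ('i, 'b) salg \<Rightarrow> ('a \<Rightarrow> 'b) \<Rightarrow> bool" where
  "salg_iso I S T h \<longleftrightarrow>
    bij_betw h (elems S) (elems T) \<and>
    (\<forall>\<kappa>\<in>I. \<forall>x\<in>elems S. \<forall>y\<in>elems S. h (sub S \<kappa> x y) = sub T \<kappa> (h x) (h y)) \<and>
    (\<forall>\<kappa>\<in>I. h (var S \<kappa>) = var T \<kappa>)"

text \<open>
  HOL cannot quantify over types inside a formula, so the type \<open>'u\<close> from which the base set
  \<open>U\<close> is drawn is an explicit parameter. For infinite \<open>I\<close> the choice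
  \<open>'u = 'i set \<Rightarrow> 'a\<close> loses nothing: a representation over any base restricts to a subset
  of the base that is closed under the representing functions, still separates them, and has
  cardinality at most \<open>|A|\<close> to the power \<open>|I|\<close> (for \<open>|A| = 1\<close> the base is already
  a singleton); such a subset embeds into that type.
\<close>

definition representable :: "'u itself \<Rightarrow> 'i set \<Rightarrow> ('i, 'a) salg \<Rightarrow> bool" where
  "representable _ I S \<longleftrightarrow>
    (\<exists>(F :: ('i, ('i \<Rightarrow> 'u) \<Rightarrow> 'u) salg) h.
      function_substitution_algebra I F \<and> salg_iso I S F h)"

end

theory Submission
  imports Defs
begin

text \<open>
  Call \<open>\<kappa>\<close> fresh for \<open>a\<close> if \<open>w *\<^sub>\<kappa> a = a\<close> for all \<open>w\<close>. For a finite set \<open>K\<close> of indices let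
  \<open>A\<^sub>K\<close> consist of the elements for which all of \<open>K\<close> is fresh. If \<open>t\<close> takes values in \<open>A\<^sub>K\<close>, then
  substituting the \<open>t\<^sub>\<kappa>\<close> with \<open>\<kappa> \<in> K\<close> one after the other is a simultaneous substitution:
  it sends \<open>v\<^sub>\<kappa>\<close> to \<open>t\<^sub>\<kappa>\<close> and obeys the law of a function substitution algebra in
  the coordinates \<open>\<kappa> \<in> K\<close>. A reduced product of the sets \<open>A\<^sub>K\<close>, with \<open>K\<close> increasing, is then a base
  on which all coordinates behave as required. Two given elements are separated by the sequence
  that, at stage \<open>K\<close>, renames the indices in \<open>K\<close> to indices fresh for both elements, because a
  renaming can be undone; the fresh indices exist by dimension-complementedness.
\<close>

context substitution_algebra
begin

section \<open>Fresh indices\<close>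

definition fresh :: "'i \<Rightarrow> 'a \<Rightarrow> bool" where
  "fresh \<kappa> x \<longleftrightarrow> (\<forall>w\<in>elems S. sub S \<kappa> w x = x)"

lemma fresh_iff: "\<kappa> \<in> I \<Longrightarrow> fresh \<kappa> x \<longleftrightarrow> \<kappa> \<notin> dimension_set I S x"
  by (auto simp: fresh_def dimension_set_def)

lemma freshD: "fresh \<kappa> x \<Longrightarrow> w \<in> elems S \<Longrightarrow> sub S \<kappa> w x = x"
  by (simp add: fresh_def)

lemma fresh_var: "\<kappa> \<in> I \<Longrightarrow> l \<in> I \<Longrightarrow> \<kappa> \<noteq> l \<Longrightarrow> fresh \<kappa> (var S l)"
  by (simp add: fresh_def sub_var_other)

text \<open>One test suffices: associativity absorbs any \<open>w\<close>, because substituting it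
  at \<kappa> leaves \<open>var S \<nu>\<close> alone.\<close>

lemma fresh_if_fixed:
  assumes "\<kappa> \<in> I" "\<nu> \<in> I" "\<kappa> \<noteq> \<nu>" "x \<in> elems S" "sub S \<kappa> (var S \<nu>) x = x"
  shows "fresh \<kappa> x"
  unfolding fresh_def
proof
  fix w assume w: "w \<in> elems S"
  have "sub S \<kappa> w x = sub S \<kappa> w (sub S \<kappa> (var S \<nu>) x)" using assms by simp
  also have "\<dots> = sub S \<kappa> (sub S \<kappa> w (var S \<nu>)) x"
    using assms w by (simp add: sub_assoc var_closed)
  also have "\<dots> = x" using assms w by (simp add: sub_var_other)
  finally show "sub S \<kappa> w x = x" .
qed

lemma fresh_sub_same:
  assumes "\<kappa> \<in> I" "x \<in> elems S" "y \<in> elems S" "fresh \<kappa> x"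
  shows "fresh \<kappa> (sub S \<kappa> x y)"
  using assms by (auto simp: fresh_def sub_assoc[symmetric])

lemma sub_distrib_fresh:
  assumes "\<kappa> \<in> I" "l \<in> I" "\<kappa> \<noteq> l" "x \<in> elems S" "y \<in> elems S" "z \<in> elems S" "fresh l x"
  shows "sub S \<kappa> x (sub S l y z) = sub S l (sub S \<kappa> x y) (sub S \<kappa> x z)"
  using assms sub_distrib by (simp add: fresh_def)

text \<open>Distributivity asks that \<open>l\<close> be fresh for the element substituted at
  \<kappa>, which may fail for arbitrary \<open>w\<close>. A variable with a third index \<nu>
  qualifies, and testing with it is enough.\<close>

lemma fresh_sub:
  assumes "infinite I" "\<kappa> \<in> I" "l \<in> I" "\<kappa> \<noteq> l" "x \<in> elems S" "y \<in> elems S"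
    and "fresh \<kappa> x" "fresh \<kappa> y"
  shows "fresh \<kappa> (sub S l x y)"
proof -
  have "infinite (I - {\<kappa>, l})" using assms(1) by simp
  then obtain \<nu> where \<nu>: "\<nu> \<in> I" "\<nu> \<noteq> \<kappa>" "\<nu> \<noteq> l"
    by (metis Diff_iff ex_in_conv finite.emptyI insertCI)
  have "sub S \<kappa> (var S \<nu>) (sub S l x y) = sub S l x y"
    using assms \<nu> sub_distrib_fresh[of \<kappa> l "var S \<nu>" x y]
    by (simp add: fresh_var var_closed freshD)
  then show ?thesis
    using assms \<nu> fresh_if_fixed[of \<kappa> \<nu>] by (auto simp: sub_closed)
qed

section \<open>Simultaneous substitution along a list\<close>

fun iter_sub :: "'i list \<Rightarrow> ('i \<Rightarrow> 'a) \<Rightarrow> 'a \<Rightarrow> 'a" where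
  "iter_sub [] t x = x"
| "iter_sub (k # ks) t x = sub S k (t k) (iter_sub ks t x)"

lemma iter_sub_closed:
  "set ks \<subseteq> I \<Longrightarrow> t ` set ks \<subseteq> elems S \<Longrightarrow> x \<in> elems S \<Longrightarrow> iter_sub ks t x \<in> elems S"
  by (induction ks) (auto intro: sub_closed)

lemma iter_sub_cong:
  "(\<And>k. k \<in> set ks \<Longrightarrow> t k = t' k) \<Longrightarrow> iter_sub ks t x = iter_sub ks t' x"
  by (induction ks) auto

lemma iter_sub_append: "iter_sub (ks @ ls) t x = iter_sub ks t (iter_sub ls t x)"
  by (induction ks) auto

lemma iter_sub_fresh_id:
  assumes "set ks \<subseteq> I" "t ` set ks \<subseteq> elems S" "\<And>k. k \<in> set ks \<Longrightarrow> fresh k x"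
  shows "iter_sub ks t x = x"
  using assms by (induction ks) (auto simp: freshD)

lemma fresh_iter_sub_other:
  assumes "infinite I" "\<kappa> \<in> I" "set ks \<subseteq> I" "\<kappa> \<notin> set ks" "t ` set ks \<subseteq> elems S" "x \<in> elems S"
    and "fresh \<kappa> x" "\<And>k. k \<in> set ks \<Longrightarrow> fresh \<kappa> (t k)"
  shows "fresh \<kappa> (iter_sub ks t x)"
  using assms by (induction ks) (auto intro!: fresh_sub iter_sub_closed)

text \<open>The step at \<kappa> makes \<kappa> fresh because \<kappa> is fresh for
  \<open>t \<kappa>\<close>; steps at other indices preserve this.\<close>

lemma fresh_iter_sub:
  assumes "infinite I" "set ks \<subseteq> I" "t ` set ks \<subseteq> elems S" "x \<in> elems S"
    and "\<And>k l. k \<in> set ks \<Longrightarrow> l \<in> set ks \<Longrightarrow> fresh l (t k)" "\<kappa> \<in> set ks"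
  shows "fresh \<kappa> (iter_sub ks t x)"
  using assms
proof (induction ks)
  case (Cons k ks)
  show ?case
  proof (cases "\<kappa> = k")
    case True
    then show ?thesis using Cons.prems by (auto intro!: fresh_sub_same iter_sub_closed)
  next
    case False
    then have "fresh \<kappa> (iter_sub ks t x)" using Cons by auto
    then show ?thesis using False Cons.prems by (auto intro!: fresh_sub iter_sub_closed)
  qed
qed simp

lemma iter_sub_distrib:
  assumes "set ks \<subseteq> I" "\<kappa> \<in> I" "\<kappa> \<notin> set ks" "t ` set ks \<subseteq> elems S"
    and "x \<in> elems S" "y \<in> elems S" "\<And>k. k \<in> set ks \<Longrightarrow> fresh \<kappa> (t k)"
  shows "iter_sub ks t (sub S \<kappa> x y) = sub S \<kappa> (iter_sub ks t x) (iter_sub ks t y)"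
  using assms
proof (induction ks)
  case (Cons k ks)
  then show ?case by (auto simp: sub_distrib_fresh iter_sub_closed)
qed simp

text \<open>Steps behind \<kappa> in the list act first and fix \<open>var S \<kappa>\<close>; those
  in front of it act on \<open>t \<kappa>\<close>, for which their indices are fresh.\<close>

lemma iter_sub_var:
  assumes "set ks \<subseteq> I" "distinct ks" "t ` set ks \<subseteq> elems S"
    and "\<And>k l. k \<in> set ks \<Longrightarrow> l \<in> set ks \<Longrightarrow> fresh l (t k)" "\<kappa> \<in> set ks"
  shows "iter_sub ks t (var S \<kappa>) = t \<kappa>"
proof -
  obtain as bs where ks: "ks = as @ \<kappa> # bs" using assms(5) by (meson split_list)
  have "iter_sub bs t (var S \<kappa>) = var S \<kappa>"
    using assms ks by (intro iter_sub_fresh_id) (auto intro!: fresh_var)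
  moreover have "iter_sub as t (t \<kappa>) = t \<kappa>"
    using assms ks by (intro iter_sub_fresh_id) auto
  ultimately show ?thesis using assms ks by (simp add: iter_sub_append sub_var)
qed

text \<open>This is the law of \<open>fn_sub\<close> with \<open>t\<close> as the sequence.
  Distributivity moves the substitution at \<kappa> past \<open>bs\<close>, associativity merges it
  with the step at \<kappa>, and passing \<open>as\<close> turns the substituted element into
  \<open>?X\<close>.\<close>

lemma iter_sub_sub:
  assumes inf: "infinite I" and ks: "set ks \<subseteq> I" "distinct ks" and t: "t ` set ks \<subseteq> elems S"
    and fr: "\<And>k l. k \<in> set ks \<Longrightarrow> l \<in> set ks \<Longrightarrow> fresh l (t k)" and \<kappa>: "\<kappa> \<in> set ks"
    and x: "x \<in> elems S" and y: "y \<in> elems S"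
  shows "iter_sub ks t (sub S \<kappa> x y) = iter_sub ks (t(\<kappa> := iter_sub ks t x)) y"
proof -
  obtain as bs where eq: "ks = as @ \<kappa> # bs" using \<kappa> by (meson split_list)
  let ?X = "iter_sub ks t x"
  have X: "?X \<in> elems S" using ks(1) t x by (rule iter_sub_closed)
  have frX: "fresh k ?X" if "k \<in> set ks" for k
    using fresh_iter_sub[OF inf ks(1) t x fr that] by blast
  have Xas: "iter_sub as t ?X = ?X"
    by (rule iter_sub_fresh_id) (use ks t in \<open>auto simp: eq intro!: frX[unfolded eq]\<close>)
  have cl: "iter_sub bs t x \<in> elems S" "iter_sub bs t y \<in> elems S" "t \<kappa> \<in> elems S"
    using ks t x y eq by (auto intro!: iter_sub_closed)
  have cl': "sub S \<kappa> (t \<kappa>) (iter_sub bs t x) \<in> elems S"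
    using cl ks eq by (auto intro!: sub_closed)
  have upd: "iter_sub as (t(\<kappa> := ?X)) z = iter_sub as t z"
      "iter_sub bs (t(\<kappa> := ?X)) z = iter_sub bs t z" for z
    by (rule iter_sub_cong; use ks eq in auto)+
  have split: "?X = iter_sub as t (sub S \<kappa> (t \<kappa>) (iter_sub bs t x))"
    by (simp add: eq iter_sub_append)
  have "iter_sub bs t (sub S \<kappa> x y) = sub S \<kappa> (iter_sub bs t x) (iter_sub bs t y)"
    using ks t x y eq fr by (intro iter_sub_distrib) auto
  then have "iter_sub ks t (sub S \<kappa> x y)
      = iter_sub as t (sub S \<kappa> (sub S \<kappa> (t \<kappa>) (iter_sub bs t x)) (iter_sub bs t y))"
    using cl ks eq by (simp add: iter_sub_append sub_assoc)
  also have "\<dots> = sub S \<kappa> ?X (iter_sub as t (iter_sub bs t y))"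
    unfolding split using ks t cl cl' eq fr by (intro iter_sub_distrib) auto
  \<comment> \<open>The indices in \<open>as\<close> are fresh for \<open>?X\<close>, so
    \<open>?X\<close> can be pulled back through \<open>as\<close> and takes the place of
    \<open>t \<kappa>\<close> in the list.\<close>
  also have "\<dots> = sub S \<kappa> (iter_sub as t ?X) (iter_sub as t (iter_sub bs t y))"
    by (simp add: Xas)
  also have "\<dots> = iter_sub as t (sub S \<kappa> ?X (iter_sub bs t y))"
    using ks t cl X eq fr by (intro iter_sub_distrib[symmetric]) auto
  also have "\<dots> = iter_sub as (t(\<kappa> := ?X)) (sub S \<kappa> ?X (iter_sub bs (t(\<kappa> := ?X)) y))"
    by (simp only: upd)
  also have "\<dots> = iter_sub ks (t(\<kappa> := ?X)) y"
    by (simp add: eq iter_sub_append)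
  finally show ?thesis .
qed

section \<open>Undoing renamings\<close>

text \<open>The renaming axiom replaces the inner \<open>var S l\<close> by
  \<open>var S \<kappa>\<close>, whose substitution at \<kappa> changes nothing; freshness of
  \<open>l\<close> then removes the outer substitution.\<close>

lemma rename_back:
  assumes "\<kappa> \<in> I" "l \<in> I" "\<kappa> \<noteq> l" "z \<in> elems S" "fresh l z"
  shows "sub S l (var S \<kappa>) (sub S \<kappa> (var S l) z) = z"
proof -
  have "sub S l (var S \<kappa>) (sub S \<kappa> (var S l) z) = sub S l (var S \<kappa>) (sub S \<kappa> (var S \<kappa>) z)"
    using assms by (intro sub_rename) (auto simp: var_closed sub_var_other)
  also have "\<dots> = z" using assms by (simp add: var_sub var_closed freshD)
  finally show ?thesis .
qed

text \<open>Renamings are undone outermost first. Injectivity and disjointness from the list keep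
  \<open>m k\<close> fresh for the result of the inner renamings, so \<open>rename_back\<close>
  applies.\<close>

lemma iter_rename_inj:
  assumes "infinite I" "set ks \<subseteq> I" "distinct ks" "inj_on m (set ks)"
    and "m ` set ks \<subseteq> I - set ks" "x \<in> elems S" "y \<in> elems S"
    and "\<And>k. k \<in> set ks \<Longrightarrow> fresh (m k) x" "\<And>k. k \<in> set ks \<Longrightarrow> fresh (m k) y"
    and "iter_sub ks (\<lambda>k. var S (m k)) x = iter_sub ks (\<lambda>k. var S (m k)) y"
  shows "x = y"
  using assms
proof (induction ks)
  case (Cons k ks)
  have k: "k \<in> I" "m k \<in> I" "k \<noteq> m k" using Cons.prems by auto
  have undo: "sub S (m k) (var S k) (iter_sub (k # ks) (\<lambda>k. var S (m k)) z)
      = iter_sub ks (\<lambda>k. var S (m k)) z"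
    if "z \<in> elems S" "fresh (m k) z" for z
    unfolding iter_sub.simps
    using that k Cons.prems
    by (intro rename_back fresh_iter_sub_other iter_sub_closed)
      (auto intro!: fresh_var var_closed dest: inj_onD)
  have "iter_sub ks (\<lambda>k. var S (m k)) x = iter_sub ks (\<lambda>k. var S (m k)) y"
    using undo[of x] undo[of y] Cons.prems by (metis list.set_intros(1))
  moreover have "m ` set ks \<subseteq> I - set ks" using Cons.prems(5) by auto
  ultimately show ?case using Cons by (auto simp: inj_on_insert)
qed simp

section \<open>The filter of finite renamings\<close>

text \<open>
  The base of the representation has to consist of functions on sets of indices, so the stages of
  the reduced product are coded as such sets: a finite renaming is a finite subset of
  \<open>I \<times> I\<close>, and \<open>I \<times> I\<close> is equinumerous to \<open>I\<close>.
\<close>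

lemma renaming_filter:
  assumes dc: "dimension_complemented I S"
  obtains F :: "'i set filter" and ks :: "'i set \<Rightarrow> 'i list" and m :: "'i set \<Rightarrow> 'i \<Rightarrow> 'i"
  where "F \<noteq> bot"
    and "\<And>J. distinct (ks J)" "\<And>J. set (ks J) \<subseteq> I" "\<And>J. m J ` I \<subseteq> I - set (ks J)"
      "\<And>J. inj_on (m J) (set (ks J))"
    and "\<And>\<kappa>. \<kappa> \<in> I \<Longrightarrow> eventually (\<lambda>J. \<kappa> \<in> set (ks J)) F"
    and "\<And>x. x \<in> elems S \<Longrightarrow> eventually (\<lambda>J. \<forall>k\<in>set (ks J). fresh (m J k) x) F"
proof -
  have inf: "infinite (I - (\<Union>x\<in>X. dimension_set I S x))" if "finite X" "X \<subseteq> elems S" for X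
    using dc that by (auto simp: dimension_complemented_def)
  have "infinite I" using inf[of "{}"] by simp
  then have "(card_of (I \<times> I), card_of I) \<in> ordIso" by (rule card_of_Times_same_infinite)
  then obtain e where "bij_betw e (I \<times> I) I" using card_of_ordIso by blast
  then have e: "inj_on e (I \<times> I)" by (rule bij_betw_imp_inj_on)
  define good where "good = (\<lambda>(l :: 'i list, m :: 'i \<Rightarrow> 'i).
    distinct l \<and> set l \<subseteq> I \<and> m ` I \<subseteq> I - set l \<and> inj_on m (set l))"
  define code where "code = (\<lambda>(l :: 'i list, m :: 'i \<Rightarrow> 'i). e ` (\<lambda>k. (k, m k)) ` set l)"
  \<comment> \<open>A code forgets the order of the list and the values of \<open>m\<close> off it,
    so \<open>rd\<close> merely chooses some decoding. The default \<open>([], id)\<close> satisfies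
    \<open>good\<close>.\<close>
  define rd where "rd J = (if \<exists>p. good p \<and> code p = J then SOME p. good p \<and> code p = J else ([], id))"
    for J
  have good_rd: "good (rd J)" for J
  proof (cases "\<exists>p. good p \<and> code p = J")
    case True
    then show ?thesis using someI_ex[OF True] by (simp add: rd_def)
  qed (auto simp: rd_def good_def)
  have code_rd: "code (rd (code p)) = code p" if "good p" for p
  proof -
    have *: "\<exists>q. good q \<and> code q = code p" using that by blast
    show ?thesis using someI_ex[OF *] * by (simp add: rd_def)
  qed
  have good_pairs: "(\<lambda>k. (k, m k)) ` set l \<subseteq> I \<times> I" if "good (l, m)" for l m
  proof -
    have "set l \<subseteq> I" "m ` I \<subseteq> I - set l" using that by (auto simp: good_def)
    then show ?thesis by blast
  qed
  have rd_code: "set (fst (rd (code (l, m)))) = set l \<and> (\<forall>k\<in>set l. snd (rd (code (l, m))) k = m k)"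
    if g: "good (l, m)" for l m
  proof -
    obtain l' m' where r: "rd (code (l, m)) = (l', m')" by fastforce
    have g': "good (l', m')" using good_rd[of "code (l, m)"] r by simp
    have "e ` (\<lambda>k. (k, m' k)) ` set l' = e ` (\<lambda>k. (k, m k)) ` set l"
      using code_rd[OF g] r by (simp add: code_def)
    moreover have "(\<lambda>k. (k, m' k)) ` set l' \<subseteq> I \<times> I" "(\<lambda>k. (k, m k)) ` set l \<subseteq> I \<times> I"
      using good_pairs[OF g'] good_pairs[OF g] .
    ultimately have eq: "(\<lambda>k. (k, m' k)) ` set l' = (\<lambda>k. (k, m k)) ` set l"
      using e by (simp add: inj_on_image_eq_iff)
    then have "fst ` (\<lambda>k. (k, m' k)) ` set l' = fst ` (\<lambda>k. (k, m k)) ` set l" by simp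
    then have "set l' = set l" by (simp add: image_image)
    then show ?thesis using eq r by auto
  qed
  have ex: "\<exists>p. good p \<and> set (fst p) = K \<and> (\<forall>k\<in>K. \<forall>x\<in>X. fresh (snd p k) x)"
    if K: "finite K" "K \<subseteq> I" and X: "finite X" "X \<subseteq> elems S" for K X
  proof -
    let ?R = "I - (\<Union>x\<in>X. dimension_set I S x) - K"
    have R: "infinite ?R" using inf[OF X] K by simp
    then obtain B where B: "finite B" "card B = card K" "B \<subseteq> ?R"
      using infinite_arbitrarily_large by blast
    then obtain f where f: "bij_betw f K B"
      using K by (metis finite_same_card_bij)
    obtain \<mu> where \<mu>: "\<mu> \<in> ?R" using R by (metis ex_in_conv finite.emptyI)
    obtain l where l: "set l = K" "distinct l" using K(1) finite_distinct_list by blast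
    \<comment> \<open>\<open>good\<close> constrains \<open>m\<close> on all of \<open>I\<close>, so
      that \<open>g \<kappa>\<close> will lie in \<open>G\<close> even at stages without \<kappa>;
      hence the value \<mu> off \<open>K\<close>.\<close>
    define m where "m k = (if k \<in> K then f k else \<mu>)" for k
    have mR: "m k \<in> ?R" for k
      using f B(3) \<mu> by (auto simp: m_def bij_betw_def)
    have "inj_on m K"
      using f by (auto simp: m_def bij_betw_def inj_on_def)
    then have "good (l, m)" using l K(2) mR by (auto simp: good_def)
    moreover have "fresh (m k) x" if "x \<in> X" for k x
      using mR[of k] that by (subst fresh_iff) auto
    ultimately show ?thesis using l by (intro exI[of _ "(l, m)"]) auto
  qed
  \<comment> \<open>A finite subset of this sum bundles the indices to be renamed with the elements
    for which the new names must be fresh.\<close>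
  define A where "A = I <+> elems S"
  have "\<exists>p. good p \<and> set (fst p) = Inl -` Z \<and>
      (\<forall>k\<in>Inl -` Z. \<forall>x\<in>Inr -` Z. fresh (snd p k) x)" if "finite Z" "Z \<subseteq> A" for Z
  proof (rule ex)
    show "Inl -` Z \<subseteq> I" "Inr -` Z \<subseteq> elems S" using that by (auto simp: A_def)
  qed (simp_all add: that finite_vimageI)
  then obtain p where p: "\<And>Z. finite Z \<Longrightarrow> Z \<subseteq> A \<Longrightarrow> good (p Z) \<and> set (fst (p Z)) = Inl -` Z \<and>
      (\<forall>k\<in>Inl -` Z. \<forall>x\<in>Inr -` Z. fresh (snd (p Z) k) x)"
    by metis
  define F where "F = filtermap (\<lambda>Z. code (p Z)) (finite_subsets_at_top A)"
  have evF: "eventually P F"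
    if "a \<in> A" "\<And>Z. finite Z \<Longrightarrow> Z \<subseteq> A \<Longrightarrow> a \<in> Z \<Longrightarrow> P (code (p Z))" for P a
    unfolding F_def eventually_filtermap eventually_finite_subsets_at_top
    using that by (intro exI[of _ "{a}"]) auto
  have dec: "set (fst (rd (code (p Z)))) = Inl -` Z \<and>
      (\<forall>k\<in>Inl -` Z. snd (rd (code (p Z))) k = snd (p Z) k)" if "finite Z" "Z \<subseteq> A" for Z
    using p[OF that] rd_code[of "fst (p Z)" "snd (p Z)"] by simp
  show ?thesis
  proof (rule that[of F "\<lambda>J. fst (rd J)" "\<lambda>J. snd (rd J)"])
    show "F \<noteq> bot" by (simp add: F_def filtermap_bot_iff)
    show "distinct (fst (rd J))" "set (fst (rd J)) \<subseteq> I" "snd (rd J) ` I \<subseteq> I - set (fst (rd J))"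
      "inj_on (snd (rd J)) (set (fst (rd J)))" for J
      using good_rd[of J] by (auto simp: good_def split: prod.splits)
    show "\<forall>\<^sub>F J in F. \<kappa> \<in> set (fst (rd J))" if "\<kappa> \<in> I" for \<kappa>
      by (rule evF[of "Inl \<kappa>"]) (use that dec in \<open>auto simp: A_def\<close>)
    show "\<forall>\<^sub>F J in F. \<forall>k\<in>set (fst (rd J)). fresh (snd (rd J) k) x" if "x \<in> elems S" for x
      by (rule evF[of "Inr x"]) (use that dec p in \<open>auto simp: A_def\<close>)
  qed
qed

section \<open>The representation on the reduced product\<close>

text \<open>Classes are replaced by chosen representatives, so that the base stays a set of
  functions from \<open>'i set\<close> to \<open>'a\<close>. Identities that hold eventually become
  equalities after \<open>c\<close>.\<close>

lemma representable_if_dimension_complemented: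
  assumes dc: "dimension_complemented I S"
  shows "representable TYPE('i set \<Rightarrow> 'a) I S"
proof -
  have inf: "infinite I"
    using dc unfolding dimension_complemented_def
    by (metis Diff_empty UN_empty empty_subsetI finite.emptyI)
  obtain F :: "'i set filter" and ks m where F: "F \<noteq> bot"
    and ks: "\<And>J. distinct (ks J)" "\<And>J. set (ks J) \<subseteq> I"
    and m: "\<And>J. m J ` I \<subseteq> I - set (ks J)" "\<And>J. inj_on (m J) (set (ks J))"
    and ev_ks: "\<And>\<kappa>. \<kappa> \<in> I \<Longrightarrow> eventually (\<lambda>J. \<kappa> \<in> set (ks J)) F"
    and ev_m: "\<And>x. x \<in> elems S \<Longrightarrow> eventually (\<lambda>J. \<forall>k\<in>set (ks J). fresh (m J k) x) F"
    by (rule renaming_filter[OF dc]) blast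
  define G where "G = {g. \<forall>J. g J \<in> elems S \<and> (\<forall>k\<in>set (ks J). fresh k (g J))}"
  define eqv where "eqv g h \<longleftrightarrow> eventually (\<lambda>J. g J = h J) F" for g h :: "'i set \<Rightarrow> 'a"
  have eqv_refl: "eqv g g" for g by (simp add: eqv_def)
  have eqv_sym: "eqv g h \<Longrightarrow> eqv h g" for g h by (simp add: eqv_def eq_commute)
  have eqv_trans: "eqv g h \<Longrightarrow> eqv h k \<Longrightarrow> eqv g k" for g h k
    unfolding eqv_def by (erule (1) eventually_elim2) simp
  define c where "c g = (SOME h. h \<in> G \<and> eqv g h)" for g
  have c: "c g \<in> G \<and> eqv g (c g)" if "g \<in> G" for g
    unfolding c_def by (rule someI[of _ g]) (simp add: that eqv_refl)
  have c_eq: "c g = c h" if "eqv g h" for g h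
    using that eqv_sym eqv_trans unfolding c_def by metis
  define U where "U = c ` G"
  define g where "g \<kappa> J = var S (m J \<kappa>)" for \<kappa> J
  have g: "g \<kappa> \<in> G" if "\<kappa> \<in> I" for \<kappa>
    unfolding G_def g_def using m(1) ks(2) that by (fastforce intro!: fresh_var var_closed)
  text \<open>
    \<open>d \<kappa>\<close> picks representatives of the classes in \<open>U\<close>. It is tuned in the coordinate \<open>\<kappa>\<close> so that
    the separating sequence of classes \<open>c (g \<kappa>)\<close> is represented by \<open>g\<close> itself: a representative
    agreeing with \<open>g \<kappa>\<close> only eventually would not do, as the stage would depend on \<open>\<kappa>\<close>.
  \<close>
  define d where "d \<kappa> u = (if u = c (g \<kappa>) then g \<kappa> else u)" for \<kappa> u
  have dG: "d \<kappa> u \<in> G" if "\<kappa> \<in> I" "u \<in> U" for \<kappa> u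
    using that g c by (auto simp: d_def U_def)
  have d_eqv: "eqv (d \<kappa> u) u" if "\<kappa> \<in> I" for \<kappa> u
    using that g c by (auto simp: d_def eqv_refl)
  have c_id: "c u = u" if "u \<in> U" for u
    using that c c_eq unfolding U_def by (metis (no_types, lifting) imageE)
  \<comment> \<open>Stage \<open>J\<close> ignores the coordinates outside \<open>ks J\<close>; each
    index in \<open>I\<close> is eventually taken into account.\<close>
  define v where "v s x J = iter_sub (ks J) (\<lambda>k. d k (s k) J) x" for s x J
  define f where "f x = (\<lambda>s\<in>I \<rightarrow>\<^sub>E U. c (v s x))" for x
  have t: "d k (s k) J \<in> elems S \<and> (\<forall>l\<in>set (ks J). fresh l (d k (s k) J))"
    if "s \<in> I \<rightarrow>\<^sub>E U" "k \<in> I" for s k J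
    using dG[of k "s k"] that by (auto simp: G_def)
  have t': "(\<lambda>k. d k (s k) J) ` set (ks J) \<subseteq> elems S" if "s \<in> I \<rightarrow>\<^sub>E U" for s J
    using t[OF that] ks(2) by blast
  have vG: "v s x \<in> G" if "s \<in> I \<rightarrow>\<^sub>E U" "x \<in> elems S" for s x
    unfolding G_def v_def
    using that t[OF that(1)] t'[OF that(1)] ks(2) inf
    by (auto intro!: iter_sub_closed fresh_iter_sub simp: subset_iff)
  have fU: "f x s \<in> U" if "s \<in> I \<rightarrow>\<^sub>E U" "x \<in> elems S" for s x
    using that vG by (simp add: f_def U_def)
  have f_fn: "f x \<in> fn_space I U" if "x \<in> elems S" for x
    using fU[OF _ that] by (auto simp: fn_space_def f_def)
  have f_var: "f (var S \<kappa>) = fn_var I U \<kappa>" if \<kappa>: "\<kappa> \<in> I" for \<kappa>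
    unfolding f_def fn_var_def
  proof (rule restrict_ext)
    fix s assume s: "s \<in> I \<rightarrow>\<^sub>E U"
    have "eventually (\<lambda>J. v s (var S \<kappa>) J = d \<kappa> (s \<kappa>) J) F"
      using ev_ks[OF \<kappa>]
    proof eventually_elim
      case (elim J)
      show ?case unfolding v_def
        using elim t[OF s] t'[OF s] ks by (intro iter_sub_var) blast+
    qed
    then have "eqv (v s (var S \<kappa>)) (s \<kappa>)"
      using d_eqv[OF \<kappa>] eqv_trans unfolding eqv_def[symmetric] by blast
    then have "c (v s (var S \<kappa>)) = c (s \<kappa>)" by (rule c_eq)
    then show "c (v s (var S \<kappa>)) = s \<kappa>" using c_id s \<kappa> by auto
  qed
  have f_sub: "f (sub S \<kappa> x y) = fn_sub I U \<kappa> (f x) (f y)"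
    if \<kappa>: "\<kappa> \<in> I" and x: "x \<in> elems S" and y: "y \<in> elems S" for \<kappa> x y
    unfolding fn_sub_def f_def[of "sub S \<kappa> x y"]
  proof (rule restrict_ext)
    fix s assume s: "s \<in> I \<rightarrow>\<^sub>E U"
    let ?s = "s(\<kappa> := f x s)"
    have s': "?s \<in> I \<rightarrow>\<^sub>E U" using s fU[OF s x] \<kappa> by (auto simp: PiE_iff extensional_def)
    have "eqv (v s x) (f x s)" using c[OF vG[OF s x]] s by (simp add: f_def)
    \<comment> \<open>At \<kappa>, \<open>v ?s\<close> uses \<open>d \<kappa> (f x s)\<close>, while
      the law at each stage supplies \<open>v s x\<close>. Eventual agreement of the two is
      enough.\<close>
    then have "eqv (d \<kappa> (f x s)) (v s x)" using d_eqv[OF \<kappa>] eqv_trans eqv_sym by blast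
    then have "eventually (\<lambda>J. v s (sub S \<kappa> x y) J = v ?s y J) F"
      unfolding eqv_def using ev_ks[OF \<kappa>]
    proof eventually_elim
      case (elim J)
      have "v s (sub S \<kappa> x y) J
          = iter_sub (ks J) ((\<lambda>k. d k (s k) J)(\<kappa> := iter_sub (ks J) (\<lambda>k. d k (s k) J) x)) y"
        unfolding v_def
        using inf elim t[OF s] t'[OF s] ks x y by (intro iter_sub_sub) blast+
      also have "\<dots> = v ?s y J"
        using elim unfolding v_def by (intro iter_sub_cong) auto
      finally show ?case .
    qed
    then have "c (v s (sub S \<kappa> x y)) = c (v ?s y)" by (intro c_eq) (simp add: eqv_def)
    then show "c (v s (sub S \<kappa> x y)) = f y ?s" using s' by (simp add: f_def)
  qed
  have f_inj: "inj_on f (elems S)"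
  proof (rule inj_onI)
    fix x y assume x: "x \<in> elems S" and y: "y \<in> elems S" and eq: "f x = f y"
    define s where "s = (\<lambda>\<kappa>\<in>I. c (g \<kappa>))"
    have s: "s \<in> I \<rightarrow>\<^sub>E U" using g by (auto simp: s_def U_def)
    have vs: "v s z J = iter_sub (ks J) (\<lambda>k. var S (m J k)) z" for z J
      unfolding v_def using ks(2)[of J]
      by (intro iter_sub_cong) (auto simp: s_def d_def g_def subset_iff)
    have "c (v s x) = c (v s y)" using fun_cong[OF eq, of s] s by (simp add: f_def)
    then have "eqv (v s x) (v s y)" using c vG[OF s x] vG[OF s y] eqv_trans eqv_sym by metis
    \<comment> \<open>The proposition \<open>x = y\<close> does not depend on \<open>J\<close>, so
      with \<open>F\<close> proper it is true once it holds eventually.\<close>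
    then have "eventually (\<lambda>J. x = y) F"
      using ev_m[OF x] ev_m[OF y] unfolding eqv_def
    proof eventually_elim
      case (elim J)
      have "m J ` set (ks J) \<subseteq> I - set (ks J)" using m(1) ks(2) by blast
      then show ?case
        using elim
        by (intro iter_rename_inj[of "ks J" "m J", OF inf ks(2,1) m(2) _ x y]) (auto simp: vs)
    qed
    then show "x = y" using F by (auto dest: eventually_happens)
  qed
  have "I \<noteq> {}" using inf by auto
  then have "U \<noteq> {}" using g by (auto simp: U_def)
  let ?F = "\<lparr>elems = f ` elems S, sub = fn_sub I U, var = fn_var I U\<rparr>"
  have "function_substitution_algebra I ?F"
    unfolding function_substitution_algebra_def
  proof (intro exI[of _ U] exI[of _ "f ` elems S"] conjI)
    show "U \<noteq> {}" by fact
    show "f ` elems S \<subseteq> fn_space I U" using f_fn by blast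
    show "\<forall>\<kappa>\<in>I. \<forall>a\<in>f ` elems S. \<forall>b\<in>f ` elems S. fn_sub I U \<kappa> a b \<in> f ` elems S"
      by (auto simp: f_sub[symmetric] intro!: sub_closed)
    show "\<forall>\<kappa>\<in>I. fn_var I U \<kappa> \<in> f ` elems S"
      by (auto simp: f_var[symmetric] intro!: var_closed)
  qed simp
  moreover have "salg_iso I S ?F f"
    using f_inj f_sub f_var by (auto simp: salg_iso_def bij_betw_def)
  ultimately show ?thesis unfolding representable_def by blast
qed

end

theorem theorem4p4:
  fixes r :: "'i rel" and S :: "('i, 'a) salg"
  assumes "Well_order r"
    and "substitution_algebra (Field r) S"
    and "dimension_complemented (Field r) S"
  shows "representable TYPE('i set \<Rightarrow> 'a) (Field r) S"
  using assms(2,3) by (rule substitution_algebra.representable_if_dimension_complemented)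

end
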